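(* Let $k$ be a positive integer and let $G$ be a connected graph with minimum degree $\delta\geq 2k$ and order $n\geq 2\delta+2$. If $$e(G)\geq \binom{\delta+1}{2}+\binom{n-\delta-1}{2}+k,$$ then $\tau(G)\geq k$.
   Context: All graphs are finite, undirected and simple. The order of a graph is its number of vertices, and $e(G)$ is the number of edges of $G$. The spanning tree packing number $\tau(G)$ is the maximum number of pairwise edge-disjoint spanning trees contained in $G$. *)

theory Defs
  imports "Graph_Theory.Graph_Theory"
begin

text \<open>
  A finite simple graph is a \<^locale>\<open>pair_graph\<close>: a finite vertex set with a symmetric,
  irreflexive set of arcs, in which the undirected edge \<open>{u, v}\<close> is represented by the two arcs
  \<open>(u, v)\<close> and \<open>(v, u)\<close>.
\<close>

definition edge_set :: "'a pair_pre_digraph \<Rightarrow> 'a set set" where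
  "edge_set G = {{u, v} | u v. (u, v) \<in> parcs G}"

definition num_edges :: "'a pair_pre_digraph \<Rightarrow> nat" where
  "num_edges G = card (edge_set G)"

text \<open>
  In a \<^locale>\<open>pair_graph\<close> the out-degree of \<open>v\<close> is the number of edges at \<open>v\<close>. The minimum is
  meaningful only for a nonempty vertex set, which \<^const>\<open>Digraph_Component.connected\<close> entails.
\<close>

definition min_degree :: "'a pair_pre_digraph \<Rightarrow> nat" where
  "min_degree G = Min (out_degree (with_proj G) ` pverts G)"

text \<open>
  The predicate \<^const>\<open>Digraph_Component.tree\<close> is not usable for symmetric digraphs, because the
  closed walk \<open>a, b, a\<close> counts as a \<^const>\<open>pre_digraph.cycle\<close>. In a \<^locale>\<open>pair_graph\<close>
  the cycles of length at least 3 are exactly the cycles of the undirected graph.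
\<close>

definition undirected_tree :: "'a pair_pre_digraph \<Rightarrow> bool" where
  "undirected_tree T \<longleftrightarrow>
     pair_graph T \<and> Digraph_Component.connected (with_proj T) \<and>
     \<not> (\<exists>p. pre_digraph.cycle (with_proj T) p \<and> 3 \<le> length p)"

definition undirected_spanning_tree :: "'a pair_pre_digraph \<Rightarrow> 'a pair_pre_digraph \<Rightarrow> bool" where
  "undirected_spanning_tree T G \<longleftrightarrow> undirected_tree T \<and> spanning (with_proj T) (with_proj G)"

definition tree_packing :: "'a pair_pre_digraph \<Rightarrow> 'a pair_pre_digraph set \<Rightarrow> bool" where
  "tree_packing G \<T> \<longleftrightarrow>
     (\<forall>T \<in> \<T>. undirected_spanning_tree T G) \<and>
     pairwise (\<lambda>T T'. disjnt (edge_set T) (edge_set T')) \<T>"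

text \<open>
  For a finite graph there are only finitely many subgraphs and the empty packing is admissible,
  so the maximum is attained. On at least two vertices spanning trees have edges, so
  edge-disjoint trees are distinct and sets of trees lose nothing against families.
\<close>

definition spanning_tree_packing_number :: "'a pair_pre_digraph \<Rightarrow> nat" where
  "spanning_tree_packing_number G = Max (card ` {\<T>. tree_packing G \<T>})"

end

theory Submission
  imports Defs "HOL-Library.Disjoint_Sets"
begin

text \<open>By the theorem of Nash-Williams and Tutte (\<open>nash_williams_tutte\<close>),
  \<open>k\<close> edge-disjoint spanning trees exist as soon as every partition of the vertex set
  into \<open>t\<close> parts is crossed by at least \<open>k * (t - 1)\<close> edges. Suppose that
  some partition is crossed by fewer. The numbers of edges leaving the parts then sum to less than
  \<open>2 * k * (t - 1)\<close>, so at least two parts are left by fewer than \<open>2 * k\<close>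
  edges each. By the minimum degree condition a part with at most \<open>\<delta>\<close> vertices
  is left by at least \<open>\<delta> \<ge> 2 * k\<close> edges, so these two parts have at least
  \<open>\<delta> + 1\<close> vertices. Under this constraint the number of edges inside the parts
  plus \<open>k * (t - 1)\<close> is largest for two parts with \<open>\<delta> + 1\<close> and
  \<open>n - \<delta> - 1\<close> vertices, and the graph has fewer edges than assumed
  (\<open>crossing_ge_if_many_edges\<close>).

  The theorem of Nash-Williams and Tutte follows from a statement about matroids
  (\<open>ex_indep_packing_spanning\<close>), proved with a closure operator that has the exchange
  property: there are \<open>k\<close> disjoint independent sets and a set \<open>R\<close>
  containing all uncovered elements such that each of the independent sets spans \<open>R\<close> by
  its elements in \<open>R\<close>. For the graphic matroid, counting edges inside and outside
  \<open>R\<close> shows that all \<open>k\<close> forests are spanning trees.\<close>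

section \<open>Disjoint independent sets in a matroid\<close>

text \<open>A matroid closure operator, defined on all subsets of the type: the last assumption is
  the Mac Lane--Steinitz exchange property.\<close>

locale exchange_closure =
  fixes cl :: "'e set \<Rightarrow> 'e set"
  assumes cl_extensive: "X \<subseteq> cl X"
    and cl_mono: "X \<subseteq> Y \<Longrightarrow> cl X \<subseteq> cl Y"
    and cl_idem: "cl (cl X) = cl X"
    and cl_exchange: "f \<in> cl (insert e X) \<Longrightarrow> f \<notin> cl X \<Longrightarrow> e \<in> cl (insert f X)"
begin

definition indep :: "'e set \<Rightarrow> bool" where
  "indep X \<longleftrightarrow> (\<forall>e\<in>X. e \<notin> cl (X - {e}))"

lemma cl_minimal: "X \<subseteq> cl Y \<Longrightarrow> cl X \<subseteq> cl Y"
  using cl_mono[of X "cl Y"] by (simp add: cl_idem)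

lemma indep_subset:
  assumes "indep Y" "X \<subseteq> Y"
  shows "indep X"
  using assms cl_mono unfolding indep_def by (meson Diff_mono order_refl subsetD)

lemma indep_insert:
  assumes "indep X" "e \<notin> cl X"
  shows "indep (insert e X)"
  unfolding indep_def
proof
  fix f assume f: "f \<in> insert e X"
  have eX: "e \<notin> X" using assms(2) cl_extensive by blast
  show "f \<notin> cl (insert e X - {f})"
  proof (cases "f = e")
    case True
    then show ?thesis using assms(2) eX by simp
  next
    case False
    then have fX: "f \<in> X" using f by simp
    have "insert e X - {f} = insert e (X - {f})" "insert f (X - {f}) = X"
      using False fX by auto
    then show ?thesis
      using cl_exchange[of f e "X - {f}"] assms fX unfolding indep_def by auto
  qed
qed

text \<open>The elements of an independent set \<open>X\<close> that can be traded for an element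
  \<open>e\<close> of its closure form the fundamental circuit of \<open>e\<close>, without
  \<open>e\<close> itself; they span \<open>e\<close>.\<close>

lemma mem_cl_fundamental_circuit:
  assumes "indep X" "finite X" "e \<in> cl X"
  shows "e \<in> cl {f \<in> X. e \<notin> cl (X - {f})}"
proof -
  have "finite (Pow X)" using assms(2) by simp
  then have fin: "finite {C \<in> Pow X. e \<in> cl C}" by simp
  have "{C \<in> Pow X. e \<in> cl C} \<noteq> {}" using assms(3) by auto
  from finite_has_minimal[OF fin this] obtain C
    where C: "C \<subseteq> X" "e \<in> cl C" and min: "\<And>D. D \<subseteq> X \<Longrightarrow> e \<in> cl D \<Longrightarrow> D \<subseteq> C \<Longrightarrow> C = D"
    by auto
  have "C \<subseteq> {f \<in> X. e \<notin> cl (X - {f})}"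
  proof
    fix f assume f: "f \<in> C"
    have "e \<notin> cl (C - {f})"
      using min[of "C - {f}"] f C(1) by auto
    moreover have "insert f (C - {f}) = C" using f by auto
    ultimately have fcl: "f \<in> cl (insert e (C - {f}))"
      using cl_exchange[of e f "C - {f}"] C(2) by simp
    have "e \<notin> cl (X - {f})"
    proof
      assume "e \<in> cl (X - {f})"
      then have "insert e (C - {f}) \<subseteq> cl (X - {f})"
        using C(1) cl_extensive[of "X - {f}"] by blast
      from cl_minimal[OF this] fcl have "f \<in> cl (X - {f})" by blast
      then show False using assms(1) f C(1) unfolding indep_def by blast
    qed
    then show "f \<in> {f \<in> X. e \<notin> cl (X - {f})}" using f C(1) by auto
  qed
  from cl_mono[OF this] C(2) show ?thesis by blast
qed

text \<open>\<open>k\<close> pairwise disjoint independent subsets of \<open>E\<close>, indexed by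
  \<open>0, \<dots>, k - 1\<close>; the values of \<open>F\<close> at other indices are
  irrelevant.\<close>

definition indep_packing :: "'e set \<Rightarrow> nat \<Rightarrow> (nat \<Rightarrow> 'e set) \<Rightarrow> bool" where
  "indep_packing E k F \<longleftrightarrow>
     (\<forall>i<k. F i \<subseteq> E \<and> indep (F i)) \<and> (\<forall>i<k. \<forall>j<k. i \<noteq> j \<longrightarrow> F i \<inter> F j = {})"

text \<open>One exchange step: an element \<open>e\<close> outside the packing enters the member
  \<open>F i\<close>, and \<open>f\<close>, which lies on the circuit that \<open>e\<close> closes
  in \<open>F i\<close>, leaves. For a packing of maximum size, every uncovered \<open>e\<close>
  closes a circuit in every member.\<close>

definition swap :: "'e set \<Rightarrow> nat \<Rightarrow> (nat \<Rightarrow> 'e set) \<Rightarrow> (nat \<Rightarrow> 'e set) \<Rightarrow> bool" where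
  "swap E k F F' \<longleftrightarrow> (\<exists>i<k. \<exists>e \<in> E - (\<Union>j<k. F j). \<exists>f \<in> F i.
     e \<notin> cl (F i - {f}) \<and> F' = F(i := insert e (F i - {f})))"

lemma indep_packing_update:
  assumes F: "indep_packing E k F" and i: "i < k" and e: "e \<in> E - (\<Union>j<k. F j)"
    and X: "X \<subseteq> F i" "e \<notin> cl X"
  shows "indep_packing E k (F(i := insert e X))"
  using assms indep_insert[OF indep_subset[OF _ X(1)] X(2)]
  unfolding indep_packing_def by auto blast+

text \<open>The nontrivial half of the matroid union theorem for \<open>k\<close> copies of one
  matroid. In a packing of maximum size, let \<open>R\<close> be the set of all elements that can be
  left uncovered after a sequence of exchanges. If \<open>e\<close> is uncovered in some reachable
  packing, then each element of its circuits can be uncovered by one more exchange, so these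
  circuits lie in \<open>R\<close> and each \<open>F i \<inter> R\<close> spans \<open>e\<close>. By
  the same observation an exchange never enlarges the closure of \<open>F i \<inter> R\<close>, so
  already the sets \<open>F i \<inter> R\<close> of the initial packing span
  \<open>R\<close>.\<close>

theorem ex_indep_packing_spanning:
  assumes "finite E"
  obtains F R where "indep_packing E k F" "E - (\<Union>i<k. F i) \<subseteq> R" "R \<subseteq> E"
    "\<forall>i<k. R \<subseteq> cl (F i \<inter> R)"
proof -
  define cov where "cov F = (\<Union>i<k. F i)" for F :: "nat \<Rightarrow> 'e set"
  have cov_E: "cov F \<subseteq> E" if "indep_packing E k F" for F
    using that unfolding cov_def indep_packing_def by auto
  define maximum where "maximum F \<longleftrightarrow> indep_packing E k F \<and>
      (\<forall>F'. indep_packing E k F' \<longrightarrow> card (cov F') \<le> card (cov F))" for F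
  have "indep_packing E k (\<lambda>_. {})" unfolding indep_packing_def indep_def by simp
  moreover have "\<forall>F. indep_packing E k F \<longrightarrow> card (cov F) < Suc (card E)"
    using cov_E card_mono[OF assms] by (simp add: le_imp_less_Suc)
  ultimately have "\<exists>F. maximum F"
    unfolding maximum_def by (rule ex_has_greatest_nat)
  then obtain F0 where F0: "maximum F0" by blast
  have spanned: "e \<in> cl (F i)" if F: "maximum F" and e: "e \<in> E - cov F" and i: "i < k" for F e i
  proof (rule ccontr)
    assume "e \<notin> cl (F i)"
    then have "indep_packing E k (F(i := insert e (F i)))"
      using indep_packing_update[of E k F i e "F i"] F e i unfolding maximum_def cov_def by auto
    then have "card (cov (F(i := insert e (F i)))) \<le> card (cov F)"
      using F unfolding maximum_def by auto
    moreover have "cov (F(i := insert e (F i))) = insert e (cov F)"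
      using i unfolding cov_def by (auto split: if_splits)
    moreover have "finite (cov F)" using F cov_E finite_subset[OF _ assms] unfolding maximum_def by auto
    ultimately show False using e by auto
  qed
  have swap_cov: "cov F' = insert e (cov F - {f})"
    if F: "maximum F" and i: "i < k" and e: "e \<in> E - cov F" and f: "f \<in> F i"
      and F': "F' = F(i := insert e (F i - {f}))" for F F' i e f
  proof -
    have "f \<notin> F j" if "j < k" "j \<noteq> i" for j
      using F i f that unfolding maximum_def indep_packing_def by blast
    then show ?thesis
      using i e f unfolding F' cov_def by (auto split: if_splits)
  qed
  have swap_maximum: "maximum F'" if F: "maximum F" and sw: "swap E k F F'" for F F'
  proof -
    from sw obtain i e f where i: "i < k" and e: "e \<in> E - cov F" and f: "f \<in> F i"
      and ne: "e \<notin> cl (F i - {f})" and F': "F' = F(i := insert e (F i - {f}))"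
      unfolding swap_def cov_def by blast
    have "indep_packing E k F'" unfolding F'
      using indep_packing_update[of E k F i e "F i - {f}"] F i e ne unfolding maximum_def cov_def by auto
    moreover have "card (cov F') = card (cov F)"
    proof -
      have "finite (cov F)" using F cov_E finite_subset[OF _ assms] unfolding maximum_def by auto
      moreover have "f \<in> cov F" using f i unfolding cov_def by auto
      moreover have "e \<notin> cov F - {f}" using e by simp
      ultimately show ?thesis
        unfolding swap_cov[OF F i e f F'] by (simp only: card_insert_disjoint finite_Diff card_Suc_Diff1 not_False_eq_True)
    qed
    ultimately show ?thesis using F unfolding maximum_def by simp
  qed
  define R where "R = (\<Union>F \<in> {F. (swap E k)\<^sup>*\<^sup>* F0 F}. E - cov F)"
  have reach_maximum: "maximum F" if "(swap E k)\<^sup>*\<^sup>* F0 F" for F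
    using that by induction (auto intro: F0 swap_maximum)
  \<comment> \<open>circuits closed by uncovered elements of reachable packings stay inside \<open>R\<close>\<close>
  have circuit: "e \<in> cl (F i \<inter> R)"
    if F: "(swap E k)\<^sup>*\<^sup>* F0 F" and e: "e \<in> E - cov F" and i: "i < k" for F e i
  proof -
    have m: "maximum F" by (rule reach_maximum[OF F])
    then have ind: "indep (F i)" and fin: "finite (F i)"
      using i finite_subset[OF _ assms] unfolding maximum_def indep_packing_def by auto
    have "{f \<in> F i. e \<notin> cl (F i - {f})} \<subseteq> F i \<inter> R"
    proof (intro subsetI IntI)
      fix f assume f: "f \<in> {f \<in> F i. e \<notin> cl (F i - {f})}"
      then show "f \<in> F i" by simp
      let ?F' = "F(i := insert e (F i - {f}))"
      have sw: "swap E k F ?F'" using f e i unfolding swap_def cov_def by blast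
      have "f \<in> cov F" using f i unfolding cov_def by auto
      then have "f \<in> E - cov ?F'"
        using swap_cov[OF m i e _ refl, of f] f e cov_E[of F] m unfolding maximum_def by auto
      then show "f \<in> R" unfolding R_def using rtranclp.rtrancl_into_rtrancl[of "swap E k", OF F sw] by blast
    qed
    from cl_mono[OF this] mem_cl_fundamental_circuit[OF ind fin spanned[OF m e i]]
    show ?thesis by blast
  qed
  \<comment> \<open>the closures only shrink along exchanges, so the initial packing has the largest ones\<close>
  have shrink: "cl (F i \<inter> R) \<subseteq> cl (F0 i \<inter> R)" if "(swap E k)\<^sup>*\<^sup>* F0 F" "i < k" for F i
    using that(1)
  proof induction
    case base
    then show ?case by simp
  next
    case (step F F')
    from step.hyps(2) obtain j e f where e: "e \<in> E - cov F"
      and F': "F' = F(j := insert e (F j - {f}))"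
      unfolding swap_def cov_def by blast
    have "F' i \<inter> R \<subseteq> cl (F i \<inter> R)"
      using circuit[OF step.hyps(1) e that(2)] cl_extensive[of "F i \<inter> R"] unfolding F' by auto
    then show ?case using cl_minimal step.IH by blast
  qed
  show thesis
  proof
    show "indep_packing E k F0" using F0 unfolding maximum_def by simp
    show "E - (\<Union>i<k. F0 i) \<subseteq> R" unfolding R_def cov_def by blast
    show "R \<subseteq> E" unfolding R_def by blast
    show "\<forall>i<k. R \<subseteq> cl (F0 i \<inter> R)"
    proof (intro allI impI subsetI)
      fix i e assume i: "i < k" and e: "e \<in> R"
      from e obtain F where "(swap E k)\<^sup>*\<^sup>* F0 F" "e \<in> E - cov F" unfolding R_def by blast
      with circuit shrink i show "e \<in> cl (F0 i \<inter> R)" by blast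
    qed
  qed
qed

end

section \<open>The graphic matroid and the Nash-Williams--Tutte theorem\<close>

text \<open>Edge sets are sets of unordered pairs; \<open>conn X\<close> relates the vertices joined
  by a path in \<open>X\<close>. It is an equivalence on the whole type, so vertices without an edge
  form singleton classes.\<close>

definition conn :: "'a set set \<Rightarrow> 'a rel" where
  "conn X = {(u, v). {u, v} \<in> X}\<^sup>*"

text \<open>The closure operator of the graphic matroid. Members of \<open>X\<close> that are not
  unordered pairs are kept, and all singletons are added as loops; so it is a closure operator on
  arbitrary families of sets.\<close>

definition edge_span :: "'a set set \<Rightarrow> 'a set set" where
  "edge_span X = X \<union> {{u, v} | u v. (u, v) \<in> conn X}"

lemma conn_refl [simp]: "(u, u) \<in> conn X"
  unfolding conn_def by simp

lemma conn_sym: "(u, v) \<in> conn X \<Longrightarrow> (v, u) \<in> conn X"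
  unfolding conn_def
  by (rule symD[OF sym_rtrancl]) (auto intro!: symI simp: insert_commute)

lemma conn_trans [trans]: "(u, v) \<in> conn X \<Longrightarrow> (v, w) \<in> conn X \<Longrightarrow> (u, w) \<in> conn X"
  unfolding conn_def by simp

lemma equiv_conn: "equiv UNIV (conn X)"
  by (intro equivI reflI symI transI) (auto intro: conn_sym conn_trans)

lemma conn_edge: "{u, v} \<in> X \<Longrightarrow> (u, v) \<in> conn X"
  unfolding conn_def by auto

lemma conn_mono: "X \<subseteq> Y \<Longrightarrow> conn X \<subseteq> conn Y"
  unfolding conn_def by (intro rtrancl_mono) auto

lemma conn_minimal: "(\<And>u v. {u, v} \<in> X \<Longrightarrow> (u, v) \<in> conn Y) \<Longrightarrow> conn X \<subseteq> conn Y"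
  unfolding conn_def by (intro rtrancl_subset_rtrancl) auto

lemma pair_in_edge_span_iff [simp]: "{u, v} \<in> edge_span X \<longleftrightarrow> (u, v) \<in> conn X"
  unfolding edge_span_def by (auto simp: doubleton_eq_iff intro: conn_edge conn_sym)

lemma conn_edge_span [simp]: "conn (edge_span X) = conn X"
proof
  show "conn (edge_span X) \<subseteq> conn X" by (rule conn_minimal) simp
  show "conn X \<subseteq> conn (edge_span X)" by (rule conn_mono) (auto simp: edge_span_def)
qed

lemma conn_insert:
  "(x, y) \<in> conn (insert {a, b} X) \<longleftrightarrow> (x, y) \<in> conn X \<or>
     (x, a) \<in> conn X \<and> (b, y) \<in> conn X \<or> (x, b) \<in> conn X \<and> (a, y) \<in> conn X" (is "?l \<longleftrightarrow> ?r x y")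
proof
  assume ?l
  then show "?r x y" unfolding conn_def[of "insert _ _"]
  proof (induction rule: rtrancl_induct)
    case base
    then show ?case by simp
  next
    case (step y z)
    from step.hyps(2) consider "{y, z} \<in> X" | "y = a" "z = b" | "y = b" "z = a"
      by (auto simp: doubleton_eq_iff)
    then show ?case
    proof cases
      case 1
      then show ?thesis using step.IH conn_trans[OF _ conn_edge] by metis
    qed (use step.IH conn_sym conn_trans in \<open>metis conn_refl\<close>)+
  qed
next
  have "X \<subseteq> insert {a, b} X" by auto
  then have X: "conn X \<subseteq> conn (insert {a, b} X)" by (rule conn_mono)
  have ab: "(a, b) \<in> conn (insert {a, b} X)" by (rule conn_edge) simp
  assume "?r x y"
  then consider "(x, y) \<in> conn X" | "(x, a) \<in> conn X" "(b, y) \<in> conn X"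
    | "(x, b) \<in> conn X" "(a, y) \<in> conn X" by blast
  then show ?l
  proof cases
    case 1
    then show ?thesis using X by blast
  next
    case 2
    then have "(x, a) \<in> conn (insert {a, b} X)" "(b, y) \<in> conn (insert {a, b} X)" using X by blast+
    then show ?thesis by (rule conn_trans[OF conn_trans[OF _ ab]])
  next
    case 3
    then have "(x, b) \<in> conn (insert {a, b} X)" "(a, y) \<in> conn (insert {a, b} X)" using X by blast+
    then show ?thesis by (rule conn_trans[OF conn_trans[OF _ conn_sym[OF ab]]])
  qed
qed

lemma conn_insert_non_pair:
  assumes "\<And>a b. e \<noteq> {a, b}"
  shows "conn (insert e X) = conn X"
proof -
  have "{(u, v). {u, v} \<in> insert e X} = {(u, v). {u, v} \<in> X}" using assms by blast
  then show ?thesis unfolding conn_def by simp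
qed

interpretation graphic: exchange_closure edge_span
proof
  show "X \<subseteq> edge_span X" for X :: "'a set set" unfolding edge_span_def by blast
  show "edge_span X \<subseteq> edge_span Y" if "X \<subseteq> Y" for X Y :: "'a set set"
    using that conn_mono[OF that] unfolding edge_span_def by blast
  show "edge_span (edge_span X) = edge_span X" for X :: "'a set set"
    unfolding edge_span_def[of "edge_span X"] conn_edge_span by (auto simp: edge_span_def)
  show "e \<in> edge_span (insert f X)" if f: "f \<in> edge_span (insert e X)" "f \<notin> edge_span X" for e f and X :: "'a set set"
  proof (cases "f = e")
    case True
    then show ?thesis unfolding edge_span_def by blast
  next
    case False
    then obtain u v where uv: "f = {u, v}" "(u, v) \<in> conn (insert e X)" "(u, v) \<notin> conn X"
      using f unfolding edge_span_def by blast
    then obtain a b where e: "e = {a, b}" using conn_insert_non_pair[of e X] by blast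
    have "(a, b) \<in> conn (insert {u, v} X)"
      using uv unfolding e conn_insert by (meson conn_sym)
    then show ?thesis by (simp add: uv e)
  qed
qed

text \<open>The edge set of the complete graph on \<open>V\<close>.\<close>

definition edges_on :: "'a set \<Rightarrow> 'a set set" where
  "edges_on V = {{u, v} | u v. u \<in> V \<and> v \<in> V \<and> u \<noteq> v}"

lemma edges_on_subset: "e \<in> edges_on V \<Longrightarrow> e \<subseteq> V"
  unfolding edges_on_def by auto

lemma quotient_conn_insert:
  assumes "a \<in> V" "b \<in> V"
  shows "V // conn (insert {a, b} X) =
    insert (conn X `` {a} \<union> conn X `` {b}) (V // conn X - {conn X `` {a}, conn X `` {b}})"
proof -
  let ?A = "conn X `` {a}" and ?B = "conn X `` {b}"
  have new: "conn (insert {a, b} X) `` {v} =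
      (if v \<in> ?A \<union> ?B then ?A \<union> ?B else conn X `` {v})" for v
    by (auto simp: conn_insert) (meson conn_sym conn_trans)+
  have old: "v \<in> ?A \<union> ?B \<longleftrightarrow> conn X `` {v} \<in> {?A, ?B}" for v
    using eq_equiv_class_iff[OF equiv_conn, of v _ X] by (auto intro: conn_sym)
  show ?thesis
  proof (intro equalityI subsetI)
    fix C assume "C \<in> V // conn (insert {a, b} X)"
    then obtain v where "v \<in> V" "C = conn (insert {a, b} X) `` {v}" by (auto elim: quotientE)
    then show "C \<in> insert (?A \<union> ?B) (V // conn X - {?A, ?B})"
      using new[of v] old[of v] by (auto intro: quotientI split: if_splits)
  next
    fix C assume C: "C \<in> insert (?A \<union> ?B) (V // conn X - {?A, ?B})"
    show "C \<in> V // conn (insert {a, b} X)"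
    proof (cases "C = ?A \<union> ?B")
      case True
      then have "C = conn (insert {a, b} X) `` {a}" using new[of a] by simp
      then show ?thesis using assms(1) by (simp add: quotientI)
    next
      case False
      then have CX: "C \<in> V // conn X" "C \<notin> {?A, ?B}" using C by blast+
      then obtain v where v: "v \<in> V" "C = conn X `` {v}" by (blast elim: quotientE)
      then have "C = conn (insert {a, b} X) `` {v}" using new[of v] old[of v] CX(2) by simp
      then show ?thesis using v(1) by (simp add: quotientI)
    qed
  qed
qed

text \<open>The independent sets of the graphic matroid are the forests, in which the number of
  edges plus the number of components is the number of vertices.\<close>

lemma card_forest:
  assumes "finite V" "F \<subseteq> edges_on V" "finite F" "graphic.indep F"
  shows "card F + card (V // conn F) = card V"
  using assms(3,2,4)
proof (induction F rule: finite_induct)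
  case empty
  have "conn {} = (Id :: 'a rel)" unfolding conn_def by auto
  then have "V // conn {} = (\<lambda>v. {v}) ` V" by (auto simp: quotient_def)
  then show ?case by (simp add: card_image)
next
  case (insert e F)
  obtain a b where e: "e = {a, b}" and V: "a \<in> V" "b \<in> V"
    using insert.prems(1) unfolding edges_on_def by auto
  let ?A = "conn F `` {a}" and ?B = "conn F `` {b}"
  have "e \<notin> edge_span F"
    using insert.prems(2) insert.hyps(2) unfolding graphic.indep_def by auto
  then have ab: "(a, b) \<notin> conn F" unfolding e by simp
  then have neq: "?A \<noteq> ?B" using eq_equiv_class_iff[OF equiv_conn, of a b F] by auto
  have mem: "?A \<in> V // conn F" "?B \<in> V // conn F" using V by (auto intro: quotientI)
  have nmem: "?A \<union> ?B \<notin> V // conn F"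
  proof
    assume "?A \<union> ?B \<in> V // conn F"
    then obtain v where "?A \<union> ?B = conn F `` {v}" by (auto elim: quotientE)
    moreover have "a \<in> ?A" "b \<in> ?B" by simp_all
    ultimately have "a \<in> conn F `` {v}" "b \<in> conn F `` {v}" by (metis UnCI)+
    then have "(v, a) \<in> conn F" "(v, b) \<in> conn F" by simp_all
    then show False using ab conn_sym conn_trans by metis
  qed
  have fin: "finite (V // conn F)" using assms(1) unfolding quotient_def by simp
  have two: "card (V // conn F - {?A, ?B}) = card (V // conn F) - 2"
    using mem neq fin by (simp add: card_Diff_subset)
  have "card {?A, ?B} \<le> card (V // conn F)" using mem fin by (intro card_mono) auto
  then have "2 \<le> card (V // conn F)" using neq by simp
  moreover have "card (V // conn (insert e F)) = Suc (card (V // conn F - {?A, ?B}))"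
    unfolding e quotient_conn_insert[OF V] using nmem fin by (simp add: card_insert_disjoint)
  moreover have "card F + card (V // conn F) = card V"
    using insert graphic.indep_subset[of "insert e F" F] by auto
  ultimately show ?case using two insert.hyps by simp
qed

lemma conn_closed:
  assumes "X \<subseteq> edges_on V" "(u, v) \<in> conn X" "u \<in> V"
  shows "v \<in> V"
  using assms(2) unfolding conn_def
proof (induction rule: rtrancl_induct)
  case base
  show ?case by (rule assms(3))
next
  case (step v w)
  then have "{v, w} \<in> edges_on V" using assms(1) by blast
  then have "{v, w} \<subseteq> V" by (rule edges_on_subset)
  then show ?case by simp
qed

lemma partition_on_quotient_conn:
  assumes "X \<subseteq> edges_on V"
  shows "partition_on V (V // conn X)"
proof (rule partition_onI)
  show "\<Union>(V // conn X) = V"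
  proof
    show "\<Union>(V // conn X) \<subseteq> V"
    proof
      fix v assume "v \<in> \<Union>(V // conn X)"
      then obtain u where "u \<in> V" "(u, v) \<in> conn X" by (auto simp: quotient_def)
      then show "v \<in> V" using conn_closed[OF assms] by metis
    qed
    show "V \<subseteq> \<Union>(V // conn X)"
    proof
      fix v assume "v \<in> V"
      then have "conn X `` {v} \<in> V // conn X" by (rule quotientI)
      moreover have "v \<in> conn X `` {v}" by simp
      ultimately show "v \<in> \<Union>(V // conn X)" by (rule UnionI)
    qed
  qed
  show "{} \<notin> V // conn X"
  proof
    assume "{} \<in> V // conn X"
    then obtain v where "{} = conn X `` {v}" by (metis quotientE)
    moreover have "v \<in> conn X `` {v}" by simp
    ultimately show False by (metis emptyE)
  qed
  show "disjnt p q" if "p \<in> V // conn X" "q \<in> V // conn X" "p \<noteq> q" for p q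
  proof -
    have "V // conn X \<subseteq> UNIV // conn X" unfolding quotient_def by blast
    then show ?thesis
      using that quotient_disj[OF equiv_conn[of X]] unfolding disjnt_def by blast
  qed
qed

text \<open>For a partition \<open>P\<close> of the vertices, the edges that join different
  parts.\<close>

definition crossing :: "'a set set \<Rightarrow> 'a set set \<Rightarrow> 'a set set" where
  "crossing E P = {e \<in> E. \<forall>A\<in>P. \<not> e \<subseteq> A}"

text \<open>The theorem of Nash-Williams and Tutte, in its nontrivial direction. Take the forests
  \<open>F i\<close> and the set \<open>R\<close> from \<open>ex_indep_packing_spanning\<close>, and
  let \<open>c\<close> be the number of components of \<open>(V, R)\<close>. Each \<open>F i
  \<inter> R\<close> has \<open>card V - c\<close> edges, and all edges outside \<open>R\<close> are
  covered; among these are the at least \<open>k * (c - 1)\<close> edges between components. Hence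
  the forests have at least \<open>k * (card V - 1)\<close> edges in total, so each of them is
  connected.\<close>

theorem nash_williams_tutte:
  assumes V: "finite V" "V \<noteq> {}" and E: "E \<subseteq> edges_on V"
    and cross: "\<And>P. partition_on V P \<Longrightarrow> k * (card P - 1) \<le> card (crossing E P)"
  obtains F where "graphic.indep_packing E k F" "\<And>i. i < k \<Longrightarrow> V \<times> V \<subseteq> conn (F i)"
proof -
  have "edges_on V \<subseteq> Pow V" unfolding edges_on_def by auto
  then have finE: "finite E" using E V(1) by (meson finite_Pow_iff finite_subset)
  obtain F R where F: "graphic.indep_packing E k F" and unc: "E - (\<Union>i<k. F i) \<subseteq> R"
    and RE: "R \<subseteq> E" and sp: "\<forall>i<k. R \<subseteq> edge_span (F i \<inter> R)"
    by (rule graphic.ex_indep_packing_spanning[OF finE, of k])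
  have Fi: "F i \<subseteq> E" "graphic.indep (F i)" "finite (F i)" "F i \<subseteq> edges_on V" if "i < k" for i
  proof -
    show "F i \<subseteq> E" "graphic.indep (F i)"
      using F that unfolding graphic.indep_packing_def by simp_all
    then show "finite (F i)" "F i \<subseteq> edges_on V"
      using E by (blast intro: finite_subset[OF _ finE])+
  qed
  let ?c = "\<lambda>X. card (V // conn X)"
  have fq: "finite (V // conn X)" for X using V(1) unfolding quotient_def by simp
  have qne: "V // conn X \<noteq> {}" for X using V(2) unfolding quotient_def by auto
  have pos: "?c X \<ge> 1" for X using fq qne card_gt_0_iff[of "V // conn X"] by (simp add: Suc_le_eq)
  have size: "card (F i) + ?c (F i) = card V" if "i < k" for i
    using card_forest[OF V(1) Fi(4)[OF that] Fi(3)[OF that] Fi(2)[OF that]] .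
  have sizeR: "card (F i \<inter> R) + ?c R = card V" if i: "i < k" for i
  proof -
    have "conn (F i \<inter> R) = conn R"
      using conn_mono[of R "edge_span (F i \<inter> R)"] sp i conn_mono[of "F i \<inter> R" R] by auto
    moreover have "graphic.indep (F i \<inter> R)"
      by (rule graphic.indep_subset[OF Fi(2)[OF i]]) simp
    ultimately show ?thesis
      using card_forest[OF V(1), of "F i \<inter> R"] Fi[OF i] by auto
  qed
  have "crossing E (V // conn R) \<subseteq> E - R"
  proof
    fix e assume "e \<in> crossing E (V // conn R)"
    then have eE: "e \<in> E" and nin: "\<forall>A \<in> V // conn R. \<not> e \<subseteq> A"
      unfolding crossing_def by simp_all
    from eE E have "e \<in> edges_on V" by (rule rev_subsetD)
    then obtain u v where uv: "e = {u, v}" "u \<in> V" unfolding edges_on_def by blast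
    have "\<not> {u, v} \<subseteq> conn R `` {u}"
      using nin quotientI[OF uv(2), of "conn R"] unfolding uv(1) by (rule bspec)
    then have "(u, v) \<notin> conn R" by simp
    then have "e \<notin> R" unfolding uv(1) using conn_edge by metis
    then show "e \<in> E - R" using eE by simp
  qed
  then have "card (crossing E (V // conn R)) \<le> card (E - R)"
    using finE by (intro card_mono) auto
  moreover have "k * (?c R - 1) \<le> card (crossing E (V // conn R))"
    by (rule cross[OF partition_on_quotient_conn]) (use RE E in auto)
  moreover have "card (E - R) \<le> (\<Sum>i<k. card (F i - R))"
  proof -
    have "E - R \<subseteq> (\<Union>i<k. F i - R)" using unc by auto
    then have "card (E - R) \<le> card (\<Union>i<k. F i - R)"
      using Fi(3) by (intro card_mono) auto
    also have "\<dots> \<le> (\<Sum>i<k. card (F i - R))" by (rule card_UN_le) simp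
    finally show ?thesis .
  qed
  ultimately have out: "k * (?c R - 1) \<le> (\<Sum>i<k. card (F i - R))" by linarith
  have "(\<Sum>i<k. ?c (F i)) \<le> k"
  proof -
    have split: "card (F i) = card (F i \<inter> R) + card (F i - R)" if "i < k" for i
      using card_Int_Diff[OF Fi(3)[OF that]] .
    have "(\<Sum>i<k. card (F i - R)) + (\<Sum>i<k. ?c (F i)) = (\<Sum>i<k. card (F i - R) + ?c (F i))"
      by (simp add: sum.distrib)
    also have "\<dots> = (\<Sum>i<k. ?c R)"
      by (intro sum.cong refl) (use size sizeR split in fastforce)
    also have "\<dots> = k * (?c R - 1) + k"
      using pos[of R] by (simp add: algebra_simps)
    finally show ?thesis using out by linarith
  qed
  have one: "?c (F i) = 1" if i: "i < k" for i
  proof (rule ccontr)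
    assume "?c (F i) \<noteq> 1"
    then have "?c (F i) > 1" using pos[of "F i"] by linarith
    then have "(\<Sum>i<k. 1) < (\<Sum>i<k. ?c (F i))"
      using i pos by (intro sum_strict_mono_ex1) auto
    then show False using \<open>(\<Sum>i<k. ?c (F i)) \<le> k\<close> by simp
  qed
  have "V \<times> V \<subseteq> conn (F i)" if i: "i < k" for i
  proof clarify
    fix u v assume uv: "u \<in> V" "v \<in> V"
    obtain C where C: "V // conn (F i) = {C}" using one[OF i] by (rule card_1_singletonE)
    have "conn (F i) `` {u} = C" "conn (F i) `` {v} = C"
      using quotientI[OF uv(1), of "conn (F i)"] quotientI[OF uv(2), of "conn (F i)"]
      unfolding C by simp_all
    moreover have "v \<in> conn (F i) `` {v}" by simp
    ultimately have "v \<in> conn (F i) `` {u}" by simp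
    then show "(u, v) \<in> conn (F i)" by simp
  qed
  then show thesis by (rule that[OF F])
qed

section \<open>Edges across a partition\<close>

text \<open>The edges with exactly one endpoint in \<open>A\<close>.\<close>

definition boundary :: "'a set set \<Rightarrow> 'a set \<Rightarrow> 'a set set" where
  "boundary E A = {e \<in> E. e \<inter> A \<noteq> {} \<and> \<not> e \<subseteq> A}"

lemma edges_on_conv: "edges_on V = {e. e \<subseteq> V \<and> card e = 2}"
  unfolding edges_on_def by (auto simp: card_2_iff)

lemma finite_edges_on: "finite V \<Longrightarrow> finite (edges_on V)"
  unfolding edges_on_conv by simp

lemma card_edges_on: "finite V \<Longrightarrow> card (edges_on V) = card V choose 2"
  unfolding edges_on_conv by (rule n_subsets)

lemma sum_card_boundary_le:
  assumes V: "finite V" and E: "E \<subseteq> edges_on V" and P: "partition_on V P"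
  shows "(\<Sum>A\<in>P. card (boundary E A)) \<le> 2 * card (crossing E P)"
proof -
  let ?C = "crossing E P"
  have finP: "finite P" using finite_elements[OF V P] .
  have finE: "finite E" using E finite_edges_on[OF V] by (rule finite_subset)
  then have finC: "finite ?C" unfolding crossing_def by simp
  have disj: "A = B" if "A \<in> P" "B \<in> P" "x \<in> A" "x \<in> B" for A B x
    using that partition_onD2[OF P] unfolding disjoint_def by (meson disjoint_iff)
  have sub: "boundary E A \<subseteq> {e \<in> ?C. e \<inter> A \<noteq> {}}" if "A \<in> P" for A
    unfolding boundary_def crossing_def using disj that by blast
  have "(\<Sum>A\<in>P. card (boundary E A)) \<le> (\<Sum>A\<in>P. card {e \<in> ?C. e \<inter> A \<noteq> {}})"
    by (intro sum_mono card_mono sub) (use finC in auto)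
  also have "\<dots> = (\<Sum>A\<in>P. \<Sum>e\<in>?C. if e \<inter> A \<noteq> {} then 1 else 0)"
    using finC by (simp add: sum.If_cases Int_def conj_commute)
  also have "\<dots> = (\<Sum>e\<in>?C. \<Sum>A\<in>P. if e \<inter> A \<noteq> {} then 1 else 0)"
    by (rule sum.swap)
  also have "\<dots> = (\<Sum>e\<in>?C. card {A \<in> P. e \<inter> A \<noteq> {}})"
    using finP by (simp add: sum.If_cases Int_def)
  also have "\<dots> \<le> (\<Sum>e\<in>?C. 2)"
  proof (rule sum_mono)
    fix e assume "e \<in> ?C"
    then have "e \<in> edges_on V" using E unfolding crossing_def by blast
    then obtain u v where e: "e = {u, v}" "u \<in> V" "v \<in> V" unfolding edges_on_def by blast
    obtain A B where A: "A \<in> P" "u \<in> A" and B: "B \<in> P" "v \<in> B"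
      using e(2,3) partition_onD1[OF P] by blast
    have "{A \<in> P. e \<inter> A \<noteq> {}} \<subseteq> {A, B}"
    proof
      fix D assume "D \<in> {A \<in> P. e \<inter> A \<noteq> {}}"
      then have "D \<in> P" "u \<in> D \<or> v \<in> D" unfolding e(1) by auto
      then show "D \<in> {A, B}" using disj A B by blast
    qed
    then have "card {A \<in> P. e \<inter> A \<noteq> {}} \<le> card {A, B}" by (intro card_mono) simp_all
    also have "\<dots> \<le> 2" by (simp add: card_insert_if)
    finally show "card {A \<in> P. e \<inter> A \<noteq> {}} \<le> 2" .
  qed
  also have "\<dots> = 2 * card ?C" by simp
  finally show ?thesis .
qed

text \<open>A vertex of \<open>A\<close> has at most \<open>card A - 1\<close> neighbours in
  \<open>A\<close>, so at least \<open>card A * (d + 1 - card A)\<close> edges leave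
  \<open>A\<close>; this is at least \<open>d\<close> for \<open>1 \<le> card A \<le>
  d\<close>.\<close>

lemma card_boundary_ge_min_degree:
  assumes V: "finite V" and E: "E \<subseteq> edges_on V"
    and deg: "\<And>v. v \<in> V \<Longrightarrow> d \<le> card {w. {v, w} \<in> E}"
    and A: "A \<subseteq> V" "A \<noteq> {}" "card A \<le> d"
  shows "d \<le> card (boundary E A)"
proof -
  have finA: "finite A" using A(1) V by (rule finite_subset)
  have finE: "finite E" using E finite_edges_on[OF V] by (rule finite_subset)
  have nb: "{w. {v, w} \<in> E} \<subseteq> V - {v}" for v
    using E unfolding edges_on_def by (auto simp: doubleton_eq_iff)
  let ?out = "\<lambda>v. {w. {v, w} \<in> E} - A"
  have out: "d + 1 - card A \<le> card (?out v)" if v: "v \<in> A" for v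
  proof -
    have fin: "finite {w. {v, w} \<in> E}" using nb[of v] V finite_subset by blast
    have "{w. {v, w} \<in> E} \<inter> A \<subseteq> A - {v}" using nb[of v] by blast
    then have "card ({w. {v, w} \<in> E} \<inter> A) \<le> card (A - {v})" using finA by (intro card_mono) simp_all
    moreover have "card (A - {v}) = card A - 1" using v by simp
    moreover have "card {w. {v, w} \<in> E} = card ({w. {v, w} \<in> E} \<inter> A) + card (?out v)"
      by (rule card_Int_Diff[OF fin])
    moreover have "d \<le> card {w. {v, w} \<in> E}" using deg v A(1) by blast
    moreover have "card A \<ge> 1" using finA A(2) by (simp add: Suc_le_eq card_gt_0_iff)
    ultimately show ?thesis by linarith
  qed
  have finout: "finite (?out v)" for v using nb[of v] V finite_subset by blast
  have "inj_on (\<lambda>(v, w). {v, w}) (Sigma A ?out)"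
    by (rule inj_onI) (auto simp: doubleton_eq_iff)
  moreover have "(\<lambda>(v, w). {v, w}) ` Sigma A ?out \<subseteq> boundary E A"
    unfolding boundary_def by auto
  ultimately have "card (Sigma A ?out) \<le> card (boundary E A)"
    using finE by (intro card_inj_on_le) (simp_all add: boundary_def)
  moreover have "card A * (d + 1 - card A) \<le> card (Sigma A ?out)"
  proof -
    have "card A * (d + 1 - card A) = (\<Sum>v\<in>A. d + 1 - card A)" by simp
    also have "\<dots> \<le> (\<Sum>v\<in>A. card (?out v))" by (intro sum_mono out)
    also have "\<dots> = card (Sigma A ?out)" using finA finout by simp
    finally show ?thesis .
  qed
  moreover have "d \<le> card A * (d + 1 - card A)"
  proof -
    obtain c where c: "d = card A + c" using A(3) le_Suc_ex by blast
    have "c \<le> card A * c" using finA A(2) by (simp add: card_gt_0_iff Suc_le_eq)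
    then show ?thesis unfolding c by (simp add: algebra_simps)
  qed
  ultimately show ?thesis by linarith
qed

lemma add_choose_two: "(x + y) choose 2 = (x choose 2) + (y choose 2) + x * y"
  by (induction y) (simp_all add: numeral_2_eq_2)

text \<open>Merging a clique of positive size into one with at least \<open>k\<close> vertices gains
  at least \<open>k\<close> edges.\<close>

lemma sum_choose_two_le:
  assumes "finite Q" "\<And>A. A \<in> Q \<Longrightarrow> 1 \<le> f A" "k \<le> b"
  shows "(b choose 2) + (\<Sum>A\<in>Q. f A choose 2) + k * card Q \<le> (b + (\<Sum>A\<in>Q. f A)) choose 2"
  using assms(1,2)
proof (induction Q rule: finite_induct)
  case empty
  then show ?case by simp
next
  case (insert A Q)
  have "k * 1 \<le> (b + sum f Q) * f A"
    using insert.prems[of A] assms(3) by (intro mult_mono) auto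
  moreover have "(b + sum f (insert A Q)) choose 2 =
      ((b + sum f Q) choose 2) + (f A choose 2) + (b + sum f Q) * f A"
    using insert.hyps add_choose_two[of "b + sum f Q" "f A"] by (simp add: ac_simps)
  ultimately show ?case using insert by simp
qed

lemma choose_two_convex:
  fixes d x y :: nat
  assumes "d \<le> x" "d \<le> y"
  shows "(x choose 2) + (y choose 2) \<le> (d choose 2) + ((x + y - d) choose 2)"
proof -
  obtain p q where p: "x = d + p" and q: "y = d + q" using assms le_Suc_ex by blast
  have "x + y - d = (d + p) + q" using p q by simp
  then show ?thesis unfolding p q
    by (simp add: add_choose_two algebra_simps)
qed

text \<open>The partition condition of \<open>nash_williams_tutte\<close> holds. If it failed for
  \<open>P\<close>, then two parts \<open>A\<close>, \<open>B\<close> would have more than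
  \<open>d\<close> vertices. Merging all parts other than \<open>A\<close> into \<open>B\<close>
  shows that the bound on the number of edges is largest for two parts, which have fewer than
  \<open>k\<close> edges between them, and by convexity for the sizes \<open>d + 1\<close> and
  \<open>card V - d - 1\<close>.\<close>

lemma crossing_ge_if_many_edges:
  assumes V: "finite V" and E: "E \<subseteq> edges_on V"
    and deg: "\<And>v. v \<in> V \<Longrightarrow> d \<le> card {w. {v, w} \<in> E}"
    and dk: "2 * k \<le> d"
    and size: "((d + 1) choose 2) + ((card V - d - 1) choose 2) + k \<le> card E"
    and P: "partition_on V P"
  shows "k * (card P - 1) \<le> card (crossing E P)"
proof (rule ccontr)
  assume "\<not> k * (card P - 1) \<le> card (crossing E P)"
  then have less: "card (crossing E P) < k * (card P - 1)" by simp
  have finP: "finite P" using finite_elements[OF V P] .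
  have part: "A \<subseteq> V" "A \<noteq> {}" "finite A" if "A \<in> P" for A
    using that partition_onD1[OF P] partition_onD3[OF P] finite_subset[OF _ V] by auto
  have finE: "finite E" using E finite_edges_on[OF V] by (rule finite_subset)
  let ?L = "{A \<in> P. d < card A}"
  \<comment> \<open>all but at most one part would have a boundary of at least \<open>2 * k\<close> edges, and the boundaries
    count each crossing edge twice\<close>
  have "\<not> card ?L \<le> 1"
  proof
    assume L: "card ?L \<le> 1"
    have "card P = card (P - ?L) + card ?L"
      using finP by (simp add: card_Diff_subset card_mono)
    then have "k * (card P - 1) \<le> k * card (P - ?L)" using L by (intro mult_le_mono) simp_all
    moreover have "(\<Sum>A \<in> P - ?L. 2 * k) \<le> (\<Sum>A \<in> P - ?L. card (boundary E A))"
    proof (rule sum_mono)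
      fix A assume "A \<in> P - ?L"
      then have "A \<in> P" "card A \<le> d" by auto
      then have "d \<le> card (boundary E A)"
        using card_boundary_ge_min_degree[OF V E deg part(1,2)] by blast
      then show "2 * k \<le> card (boundary E A)" using dk by simp
    qed
    moreover have "(\<Sum>A \<in> P - ?L. card (boundary E A)) \<le> (\<Sum>A \<in> P. card (boundary E A))"
      using finP by (intro sum_mono2) auto
    moreover have "(\<Sum>A \<in> P - ?L. 2 * k) = 2 * (k * card (P - ?L))" by simp
    ultimately show False using less sum_card_boundary_le[OF V E P] by linarith
  qed
  then have "2 \<le> card ?L" by simp
  then obtain T where T: "T \<subseteq> ?L" "card T = 2" by (meson obtain_subset_with_card_n)
  then obtain A B where AB: "A \<in> P" "B \<in> P" "A \<noteq> B" "d < card A" "d < card B"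
    by (auto simp: card_2_iff)
  define Q where "Q = P - {A, B}"
  have Q: "P = insert A (insert B Q)" "A \<notin> insert B Q" "B \<notin> Q" "finite Q"
    using AB finP unfolding Q_def by auto
  have cardP: "card P = card Q + 2" unfolding Q(1) using Q(2-4) by simp
  have "card V = (\<Sum>D\<in>P. card D)"
    using card_Union_disjoint[of P] partition_onD1[OF P] partition_onD2[OF P] part(3)
    by (simp add: disjoint_def pairwise_def disjnt_def)
  then have cardV: "card V = card A + (card B + (\<Sum>D\<in>Q. card D))"
    unfolding Q(1) using Q(2-4) by simp
  have "E \<subseteq> crossing E P \<union> (\<Union>D\<in>P. edges_on D)"
  proof
    fix e assume e: "e \<in> E"
    show "e \<in> crossing E P \<union> (\<Union>D\<in>P. edges_on D)"
    proof (cases "e \<in> crossing E P")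
      case False
      then obtain D where "D \<in> P" "e \<subseteq> D" using e unfolding crossing_def by auto
      moreover have "card e = 2" using e E unfolding edges_on_conv by blast
      ultimately show ?thesis unfolding edges_on_conv by blast
    qed simp
  qed
  then have "card E \<le> card (crossing E P \<union> (\<Union>D\<in>P. edges_on D))"
    using finP part(3) finE by (intro card_mono) (auto simp: finite_edges_on crossing_def)
  also have "\<dots> \<le> card (crossing E P) + card (\<Union>D\<in>P. edges_on D)" by (rule card_Un_le)
  also have "card (\<Union>D\<in>P. edges_on D) \<le> (\<Sum>D\<in>P. card (edges_on D))" by (rule card_UN_le[OF finP])
  also have "(\<Sum>D\<in>P. card (edges_on D)) = (\<Sum>D\<in>P. card D choose 2)"
    by (intro sum.cong refl card_edges_on part(3))
  also have "\<dots> = (card A choose 2) + ((card B choose 2) + (\<Sum>D\<in>Q. card D choose 2))"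
    unfolding Q(1) using Q(2-4) by simp
  finally have up: "card E \<le> card (crossing E P) +
      ((card A choose 2) + ((card B choose 2) + (\<Sum>D\<in>Q. card D choose 2)))" by simp
  have "1 \<le> card D" if "D \<in> Q" for D
    using that part[of D] unfolding Q(1) by (simp add: Suc_le_eq card_gt_0_iff)
  then have "(card B choose 2) + (\<Sum>D\<in>Q. card D choose 2) + k * card Q
      \<le> (card B + (\<Sum>D\<in>Q. card D)) choose 2"
    using sum_choose_two_le[OF Q(4), of card k "card B"] AB(5) dk by simp
  moreover have "(card A choose 2) + ((card B + (\<Sum>D\<in>Q. card D)) choose 2)
      \<le> ((d + 1) choose 2) + ((card V - d - 1) choose 2)"
    using choose_two_convex[of "d + 1" "card A" "card B + (\<Sum>D\<in>Q. card D)"] AB(4,5) cardV by simp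
  moreover have "card (crossing E P) < k * card Q + k" using less cardP by simp
  ultimately show False using size up by linarith
qed

section \<open>Spanning trees of symmetric digraphs\<close>

text \<open>The symmetric digraph with vertex set \<open>V\<close> that represents the undirected
  edges \<open>F\<close>.\<close>

definition graph_of :: "'a set \<Rightarrow> 'a set set \<Rightarrow> 'a pair_pre_digraph" where
  "graph_of V F = \<lparr>pverts = V, parcs = {(u, v). {u, v} \<in> F}\<rparr>"

lemma pair_graph_graph_of:
  assumes V: "finite V" and F: "F \<subseteq> edges_on V"
  shows "pair_graph (graph_of V F)"
proof -
  have arc: "u \<in> V \<and> v \<in> V \<and> u \<noteq> v" if "{u, v} \<in> F" for u v
  proof -
    have "{u, v} \<in> edges_on V" using that F by (rule rev_subsetD)
    then show ?thesis unfolding edges_on_conv by (auto simp: card_insert_if split: if_splits)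
  qed
  have "{(u, v). {u, v} \<in> F} \<subseteq> V \<times> V" using arc by auto
  then have "finite {(u, v). {u, v} \<in> F}" using V by (meson finite_SigmaI finite_subset)
  moreover have "sym {(u, v). {u, v} \<in> F}" by (auto intro!: symI simp: insert_commute)
  ultimately show ?thesis
    using V arc by unfold_locales (auto simp: graph_of_def symmetric_def)
qed

lemma edge_set_graph_of: "F \<subseteq> edges_on V \<Longrightarrow> edge_set (graph_of V F) = F"
  unfolding edge_set_def graph_of_def edges_on_def by fastforce

lemma connected_graph_of:
  assumes V: "finite V" "V \<noteq> {}" and F: "F \<subseteq> edges_on V" "V \<times> V \<subseteq> conn F"
  shows "Digraph_Component.connected (with_proj (graph_of V F))"
proof -
  let ?T = "with_proj (graph_of V F)"
  interpret T: pair_graph "graph_of V F" by (rule pair_graph_graph_of[OF V(1) F(1)])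
  have "u \<rightarrow>\<^sup>*\<^bsub>?T\<^esub> v" if u: "u \<in> V" and uv: "(u, v) \<in> conn F" for u v
    using uv unfolding conn_def
  proof (induction rule: rtrancl_induct)
    case base
    show ?case using u by (intro T.reachable_refl) (simp add: graph_of_def)
  next
    case (step v w)
    then have "(v, w) \<in> parcs (graph_of V F)" by (simp add: graph_of_def)
    with step.IH show ?case by (rule T.reachable_adj_trans)
  qed
  then show ?thesis
    using F(2) V(2) by (intro T.connectedI T.reachable_mk_symmetricI) (auto simp: graph_of_def)
qed

lemma pcas_imp_conn:
  assumes "pcas u p v" "\<And>a b. (a, b) \<in> set p \<Longrightarrow> {a, b} \<in> X"
  shows "(u, v) \<in> conn X"
  using assms
proof (induction p arbitrary: u)
  case (Cons e p)
  obtain a b where e: "e = (a, b)" by (cases e)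
  have "(b, v) \<in> conn X" using Cons e by auto
  moreover have "(u, b) \<in> conn X" using Cons.prems e by (auto intro: conn_edge)
  ultimately show ?case by (blast intro: conn_trans)
qed simp

lemma arc_verts_in_pawalk_verts:
  "pcas u p v \<Longrightarrow> (a, b) \<in> set p \<Longrightarrow> {a, b} \<subseteq> set (pawalk_verts u p)"
proof (induction p arbitrary: u)
  case (Cons e p)
  have "snd e \<in> set (pawalk_verts (snd e) p)"
    using Cons.prems(1) by (cases p) auto
  then show ?case using Cons by auto
qed simp

lemma last_in_pawalk_verts: "pcas u p v \<Longrightarrow> v \<in> set (pawalk_verts u p)"
  by (induction p arbitrary: u) auto

text \<open>In a cycle \<open>u, x, y, \<dots>, u\<close> of length at least 3, the walk from
  \<open>x\<close> back to \<open>u\<close> avoids the edge \<open>{u, x}\<close>, because \<open>y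
  \<noteq> u\<close> and \<open>x\<close> is not visited again.\<close>

lemma indep_imp_no_cycle:
  assumes F: "graphic.indep F"
  shows "\<not> (\<exists>p. pre_digraph.cycle (with_proj (graph_of V F)) p \<and> 3 \<le> length p)"
proof
  assume "\<exists>p. pre_digraph.cycle (with_proj (graph_of V F)) p \<and> 3 \<le> length p"
  then obtain u p where p: "pcas u p u" "distinct (tl (pawalk_verts u p))" "3 \<le> length p"
    and arcs: "set p \<subseteq> {(u, v). {u, v} \<in> F}"
    unfolding pre_digraph.cycle_def pre_digraph.awalk_def
    by (auto simp: cas_with_proj_eq awalk_verts_with_proj_eq graph_of_def)
  obtain e1 e2 r where "p = e1 # e2 # r" "r \<noteq> []"
    using p(3) by (cases p; cases "tl p"; cases "tl (tl p)") auto
  moreover obtain x y where "e1 = (u, x)" "e2 = (x, y)"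
    using p(1) calculation by (cases e1; cases e2) auto
  ultimately have peq: "p = (u, x) # (x, y) # r" and r: "r \<noteq> []" by simp_all
  have cas: "pcas y r u" and dist: "x \<notin> set (pawalk_verts y r)" "distinct (pawalk_verts y r)"
    using p(1,2) unfolding peq by simp_all
  have "y \<noteq> u"
  proof
    assume yu: "y = u"
    obtain e r' where re: "r = e # r'" using r by (cases r) auto
    have "pcas (snd e) r' u" using cas re by simp
    then show False using last_in_pawalk_verts dist(2) cas re yu by fastforce
  qed
  have "(x, u) \<in> conn (F - {{u, x}})"
  proof (rule pcas_imp_conn)
    show "pcas x ((x, y) # r) u" using cas by simp
    fix a b assume ab: "(a, b) \<in> set ((x, y) # r)"
    then have "{a, b} \<in> F" using arcs unfolding peq by auto
    moreover have "{a, b} \<noteq> {u, x}"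
    proof (cases "(a, b) = (x, y)")
      case True
      then show ?thesis using \<open>y \<noteq> u\<close> by (auto simp: doubleton_eq_iff)
    next
      case False
      then have "{a, b} \<subseteq> set (pawalk_verts y r)"
        using ab arc_verts_in_pawalk_verts[OF cas, of a b] by auto
      then show ?thesis using dist(1) by auto
    qed
    ultimately show "{a, b} \<in> F - {{u, x}}" by simp
  qed
  then have "{u, x} \<in> edge_span (F - {{u, x}})" by (simp add: conn_sym)
  moreover have "{u, x} \<in> F" using arcs unfolding peq by simp
  ultimately show False using F unfolding graphic.indep_def by blast
qed

lemma undirected_spanning_tree_graph_of:
  assumes G: "pair_graph G" and ne: "pverts G \<noteq> {}" and F: "F \<subseteq> edge_set G"
    and E: "edge_set G \<subseteq> edges_on (pverts G)"
    and ind: "graphic.indep F" and con: "pverts G \<times> pverts G \<subseteq> conn F"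
  shows "undirected_spanning_tree (graph_of (pverts G) F) G"
proof -
  interpret G: pair_graph G by (rule G)
  let ?T = "graph_of (pverts G) F"
  have FV: "F \<subseteq> edges_on (pverts G)" using F E by (rule subset_trans)
  have T: "pair_graph ?T" by (rule pair_graph_graph_of[OF G.pair_finite_verts FV])
  interpret T: pair_graph ?T by (rule T)
  have "parcs ?T \<subseteq> parcs G"
  proof
    fix a assume "a \<in> parcs ?T"
    then obtain u v where a: "a = (u, v)" "{u, v} \<in> edge_set G"
      using F by (cases a) (auto simp: graph_of_def)
    then show "a \<in> parcs G"
      unfolding edge_set_def by (auto simp: doubleton_eq_iff intro: G.arcs_symmetric)
  qed
  then have "spanning (with_proj ?T) (with_proj G)"
    unfolding spanning_def subgraph_def compatible_def
    using T.wf_digraph_axioms G.wf_digraph_axioms by (simp add: graph_of_def)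
  then show ?thesis
    unfolding undirected_spanning_tree_def undirected_tree_def
    using T connected_graph_of[OF G.pair_finite_verts ne FV con] indep_imp_no_cycle[OF ind]
    by blast
qed

lemma tree_packing_card_le_number:
  assumes G: "pair_graph G" and T: "tree_packing G \<T>"
  shows "card \<T> \<le> spanning_tree_packing_number G"
proof -
  interpret G: pair_graph G by (rule G)
  let ?S = "(\<lambda>A. \<lparr>pverts = pverts G, parcs = A\<rparr>) ` Pow (parcs G)"
  have "T \<in> ?S" if "undirected_spanning_tree T G" for T
  proof -
    have "pverts T = pverts G" "parcs T \<subseteq> parcs G"
      using that unfolding undirected_spanning_tree_def spanning_def subgraph_def by simp_all
    then have "T = \<lparr>pverts = pverts G, parcs = parcs T\<rparr>" "parcs T \<in> Pow (parcs G)" by simp_all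
    then show ?thesis by (rule image_eqI)
  qed
  then have "\<T> \<subseteq> ?S" if "tree_packing G \<T>" for \<T>
    using that unfolding tree_packing_def by (meson subsetI)
  then have "{\<T>. tree_packing G \<T>} \<subseteq> Pow ?S" by (metis CollectD PowI subsetI)
  moreover have "finite (Pow ?S)" using G.pair_finite_arcs by simp
  ultimately have "finite {\<T>. tree_packing G \<T>}" by (rule finite_subset)
  then have "finite (card ` {\<T>. tree_packing G \<T>})" by (rule finite_imageI)
  moreover have "card \<T> \<in> card ` {\<T>. tree_packing G \<T>}" using T by simp
  ultimately show ?thesis unfolding spanning_tree_packing_number_def by (rule Max_ge)
qed

lemma edge_set_subset_edges_on:
  assumes "pair_graph G"
  shows "edge_set G \<subseteq> edges_on (pverts G)"
proof -
  interpret G: pair_graph G by fact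
  show ?thesis
  proof
    fix e assume "e \<in> edge_set G"
    then obtain u v where "e = {u, v}" and uv: "(u, v) \<in> parcs G" unfolding edge_set_def by blast
    moreover have "u \<in> pverts G" "v \<in> pverts G" using G.wellformed'[OF uv] .
    moreover have "u \<noteq> v" by (rule G.no_loops'[OF uv])
    ultimately show "e \<in> edges_on (pverts G)" unfolding edges_on_def by blast
  qed
qed

text \<open>The vertices \<open>w\<close> with \<open>{v, w}\<close> an edge correspond to the arcs
  with tail \<open>v\<close>.\<close>

lemma min_degree_le:
  assumes "pair_graph G" "v \<in> pverts G"
  shows "min_degree G \<le> card {w. {v, w} \<in> edge_set G}"
proof -
  interpret G: pair_graph G by fact
  have "min_degree G \<le> out_degree (with_proj G) v"
    unfolding min_degree_def using assms(2) G.pair_finite_verts by (intro Min_le) auto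
  also have "\<dots> = card ((\<lambda>w. (v, w)) ` {w. (v, w) \<in> parcs G})"
    unfolding out_degree_def out_arcs_def by (rule arg_cong[of _ _ card]) auto
  also have "\<dots> = card {w. (v, w) \<in> parcs G}" by (rule card_image) (simp add: inj_on_def)
  also have "{w. (v, w) \<in> parcs G} = {w. {v, w} \<in> edge_set G}"
    unfolding edge_set_def by (auto simp: doubleton_eq_iff intro: G.arcs_symmetric)
  finally show ?thesis .
qed

theorem theorem1p1:
  fixes G :: "'a pair_pre_digraph" and k n \<delta> :: nat
  assumes "k > 0"
    and "pair_graph G"
    and "Digraph_Component.connected (with_proj G)"
    and "\<delta> = min_degree G"
    and "\<delta> \<ge> 2 * k"
    and "n = card (pverts G)"
    and "n \<ge> 2 * \<delta> + 2"
    and "num_edges G \<ge> ((\<delta> + 1) choose 2) + ((n - \<delta> - 1) choose 2) + k"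
  shows "spanning_tree_packing_number G \<ge> k"
proof -
  let ?V = "pverts G" and ?E = "edge_set G"
  interpret G: pair_graph G by fact
  have V: "finite ?V" "2 \<le> card ?V" using G.pair_finite_verts assms(6,7) by simp_all
  then have ne: "?V \<noteq> {}" by auto
  have E: "?E \<subseteq> edges_on ?V" by (rule edge_set_subset_edges_on[OF assms(2)])
  have "k * (card P - 1) \<le> card (crossing ?E P)" if "partition_on ?V P" for P
  proof (rule crossing_ge_if_many_edges[OF V(1) E _ assms(5) _ that])
    show "\<delta> \<le> card {w. {v, w} \<in> ?E}" if "v \<in> ?V" for v
      using min_degree_le[OF assms(2) that] assms(4) by simp
    show "((\<delta> + 1) choose 2) + ((card ?V - \<delta> - 1) choose 2) + k \<le> card ?E"
      using assms(6,8) unfolding num_edges_def by simp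
  qed
  then obtain F where F: "graphic.indep_packing ?E k F"
    and con: "\<And>i. i < k \<Longrightarrow> ?V \<times> ?V \<subseteq> conn (F i)"
    using nash_williams_tutte[OF V(1) ne E] by metis
  have Fi: "F i \<subseteq> ?E" "graphic.indep (F i)" "F i \<subseteq> edges_on ?V" if "i < k" for i
    using F that E unfolding graphic.indep_packing_def by auto
  have disj: "F i \<inter> F j = {}" if "i < k" "j < k" "i \<noteq> j" for i j
    using F that unfolding graphic.indep_packing_def by simp
  \<comment> \<open>with at least two vertices the trees have edges, so disjoint trees are distinct\<close>
  have nonempty: "F i \<noteq> {}" if "i < k" for i
  proof
    assume "F i = {}"
    then have "?V \<times> ?V \<subseteq> Id" using con[OF that] unfolding conn_def by simp
    moreover obtain u v where "u \<in> ?V" "v \<in> ?V" "u \<noteq> v"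
      using V by (metis card_le_Suc0_iff_eq not_less_eq_eq numeral_2_eq_2)
    ultimately show False by blast
  qed
  let ?T = "\<lambda>i. graph_of ?V (F i)"
  have es: "edge_set (?T i) = F i" if "i < k" for i
    by (rule edge_set_graph_of[OF Fi(3)[OF that]])
  have "inj_on ?T {..<k}"
  proof (rule inj_onI)
    fix i j assume ij: "i \<in> {..<k}" "j \<in> {..<k}" "?T i = ?T j"
    then have ik: "i < k" "j < k" by simp_all
    have "F i = F j" using arg_cong[OF ij(3), of edge_set] unfolding es[OF ik(1)] es[OF ik(2)] .
    then show "i = j" using disj[OF ik] nonempty[OF ik(1)] by (metis inf.idem)
  qed
  then have "card (?T ` {..<k}) = k" by (simp add: card_image)
  moreover have "tree_packing G (?T ` {..<k})"
    unfolding tree_packing_def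
  proof (intro conjI ballI pairwise_imageI)
    fix T assume "T \<in> ?T ` {..<k}"
    then obtain i where "T = ?T i" and i: "i < k" by (metis imageE lessThan_iff)
    then show "undirected_spanning_tree T G"
      using undirected_spanning_tree_graph_of[OF assms(2) ne Fi(1)[OF i] E Fi(2)[OF i] con[OF i]]
      by (simp only:)
  next
    fix i j assume "i \<in> {..<k}" "j \<in> {..<k}" and "i \<noteq> j"
    then have ij: "i < k" "j < k" "i \<noteq> j" by simp_all
    show "disjnt (edge_set (?T i)) (edge_set (?T j))"
      unfolding es[OF ij(1)] es[OF ij(2)] disjnt_def by (rule disj[OF ij])
  qed
  ultimately show ?thesis using tree_packing_card_le_number[OF assms(2)] by metis
qed

end
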